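(* Let $X$ be a real Hilbert space, let $T\colon X\to X$ be firmly nonexpansive, let $A\colon X\rightrightarrows X$ be maximally monotone, and suppose that $T=J_A$, or equivalently that $A=T^{-1}-\mathrm{Id}$. Then the following are equivalent: (i) $T$ is cyclically firmly nonexpansive. (ii) $A$ is cyclically monotone. (iii) There exists $f\in\Gamma_0$ such that $A=\partial f$. (iv) $\mathrm{Id}-T$ is cyclically firmly nonexpansive. (v) $A^{-1}$ is cyclically monotone. (vi) There exists $f\in\Gamma_0$ such that $A^{-1}=\partial f^*$. Consequently, cyclic firm nonexpansiveness is a self-dual property for firmly nonexpansive mappings; correspondingly, cyclic monotonicity is a self-dual property for maximally monotone operators.
   Context: $X$ is a real Hilbert space; $\mathrm{Id}$ is the identity on $X$. $T\colon X\to X$ is firmly nonexpansive if $\|Tx-Ty\|^2+\|(\mathrm{Id}-T)x-(\mathrm{Id}-T)y\|^2\leq\|x-y\|^2$ for all $x,y\in X$; it is cyclically firmly nonexpansive if $\sum_{i=1}^n\langle x_i-Tx_i,Tx_i-Tx_{i+1}\rangle\geq0$ for every $n\in\{2,3,\ldots\}$ and all points $x_1,\ldots,x_n\in X$, where $x_{n+1}=x_1$. For $A\colon X\rightrightarrows X$ (so $Ax\subseteq X$ for each $x$): $\operatorname{gr}A=\{(x,u):u\in Ax\}$ and $x\in A^{-1}u\Leftrightarrow u\in Ax$. $A$ is monotone if $\langle x-y,u-v\rangle\geq0$ for all $(x,u),(y,v)\in\operatorname{gr}A$, and maximally monotone if it is monotone with no proper monotone extension. $A$ is cyclically monotone if $\sum_{i=1}^n\langle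 x_{i+1}-x_i,u_i\rangle\leq0$ for every $n\geq2$ and all $(x_1,u_1),\ldots,(x_n,u_n)\in\operatorname{gr}A$, where $x_{n+1}=x_1$. The resolvent of a maximally monotone $A$ is $J_A=(\mathrm{Id}+A)^{-1}\colon X\to X$. $\Gamma_0$ is the set of convex, lower semicontinuous, proper functions $f\colon X\to\left]-\infty,+\infty\right]$; $\partial f$ is the convex subdifferential and $f^*$ the Fenchel conjugate. A property of firmly nonexpansive mappings on $X$ is self-dual if, for every firmly nonexpansive $T\colon X\to X$, $T$ has it if and only if $\mathrm{Id}-T$ has it; a property of maximally monotone operators on $X$ is self-dual if, for every maximally monotone $A$, $A$ has it if and only if $A^{-1}$ has it. *)

theory Defs
  imports "HOL-Analysis.Analysis"
begin

section \<open>Firmly nonexpansive mappings\<close>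

definition firmly_nonexpansive :: "('a::real_inner \<Rightarrow> 'a) \<Rightarrow> bool" where
  "firmly_nonexpansive T \<longleftrightarrow>
    (\<forall>x y. (norm (T x - T y))\<^sup>2 + (norm ((x - T x) - (y - T y)))\<^sup>2 \<le> (norm (x - y))\<^sup>2)"

text \<open>
  A finite cycle of points \<open>x\<^sub>1, \<dots>, x\<^sub>n\<close> is given by the values at \<open>1, \<dots>, n + 1\<close> of
  a sequence with \<open>x\<^bsub>n+1\<^esub> = x\<^sub>1\<close>; the other values of the sequence play no role.
\<close>

definition cyclically_firmly_nonexpansive :: "('a::real_inner \<Rightarrow> 'a) \<Rightarrow> bool" where
  "cyclically_firmly_nonexpansive T \<longleftrightarrow>
    (\<forall>n::nat. \<forall>x::nat \<Rightarrow> 'a. n \<ge> 2 \<longrightarrow> x (n + 1) = x 1 \<longrightarrow>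
      (\<Sum>i=1..n. (x i - T (x i)) \<bullet> (T (x i) - T (x (i + 1)))) \<ge> 0)"

section \<open>Set-valued operators\<close>

text \<open>A set-valued operator on \<open>X\<close> is a function into the subsets of \<open>X\<close>.\<close>

definition op_graph :: "('a \<Rightarrow> 'a set) \<Rightarrow> ('a \<times> 'a) set" where
  "op_graph A = {(x, u). u \<in> A x}"

definition op_inverse :: "('a \<Rightarrow> 'a set) \<Rightarrow> 'a \<Rightarrow> 'a set" where
  "op_inverse A u = {x. u \<in> A x}"

definition op_of_fun :: "('a \<Rightarrow> 'a) \<Rightarrow> 'a \<Rightarrow> 'a set" where
  "op_of_fun T x = {T x}"

definition op_add :: "('a::plus \<Rightarrow> 'a set) \<Rightarrow> ('a \<Rightarrow> 'a set) \<Rightarrow> 'a \<Rightarrow> 'a set" where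
  "op_add A B x = {u + v | u v. u \<in> A x \<and> v \<in> B x}"

text \<open>The difference is pointwise Minkowski difference, not set difference.\<close>

definition op_diff :: "('a::minus \<Rightarrow> 'a set) \<Rightarrow> ('a \<Rightarrow> 'a set) \<Rightarrow> 'a \<Rightarrow> 'a set" where
  "op_diff A B x = {u - v | u v. u \<in> A x \<and> v \<in> B x}"

definition monotone_op :: "('a::real_inner \<Rightarrow> 'a set) \<Rightarrow> bool" where
  "monotone_op A \<longleftrightarrow>
    (\<forall>(x, u) \<in> op_graph A. \<forall>(y, v) \<in> op_graph A. (x - y) \<bullet> (u - v) \<ge> 0)"

definition maximally_monotone :: "('a::real_inner \<Rightarrow> 'a set) \<Rightarrow> bool" where
  "maximally_monotone A \<longleftrightarrow>
    monotone_op A \<and> \<not> (\<exists>B. monotone_op B \<and> op_graph A \<subset> op_graph B)"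

definition cyclically_monotone :: "('a::real_inner \<Rightarrow> 'a set) \<Rightarrow> bool" where
  "cyclically_monotone A \<longleftrightarrow>
    (\<forall>n::nat. \<forall>x u :: nat \<Rightarrow> 'a. n \<ge> 2 \<longrightarrow> (\<forall>i\<in>{1..n}. (x i, u i) \<in> op_graph A) \<longrightarrow>
      x (n + 1) = x 1 \<longrightarrow> (\<Sum>i=1..n. (x (i + 1) - x i) \<bullet> u i) \<le> 0)"

text \<open>
  The resolvent \<open>(Id + A)\<^sup>-\<^sup>1\<close> is kept set-valued; that it is a mapping \<open>T\<close> defined on all
  of \<open>X\<close> is expressed by \<open>op_of_fun T = resolvent A\<close>.
\<close>

definition resolvent :: "('a::real_inner \<Rightarrow> 'a set) \<Rightarrow> 'a \<Rightarrow> 'a set" where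
  "resolvent A = op_inverse (op_add (op_of_fun id) A)"

section \<open>Convex functions with extended real values\<close>

definition proper_fun :: "('a \<Rightarrow> ereal) \<Rightarrow> bool" where
  "proper_fun f \<longleftrightarrow> (\<forall>x. f x \<noteq> -\<infinity>) \<and> (\<exists>x. f x \<noteq> \<infinity>)"

text \<open>
  Only used for functions that do not take the value \<open>-\<infinity>\<close>, so the right-hand side never
  contains \<open>\<infinity> - \<infinity>\<close>; the open range of \<open>t\<close> avoids \<open>0 * \<infinity>\<close>.
\<close>

definition convex_fun :: "('a::real_vector \<Rightarrow> ereal) \<Rightarrow> bool" where
  "convex_fun f \<longleftrightarrow>
    (\<forall>x y. \<forall>t::real. 0 < t \<longrightarrow> t < 1 \<longrightarrow>
      f ((1 - t) *\<^sub>R x + t *\<^sub>R y) \<le> ereal (1 - t) * f x + ereal t * f y)"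

definition lower_semicontinuous :: "('a::topological_space \<Rightarrow> ereal) \<Rightarrow> bool" where
  "lower_semicontinuous f \<longleftrightarrow> (\<forall>x. f x \<le> Liminf (at x) f)"

definition Gamma0 :: "('a::real_inner \<Rightarrow> ereal) set" where
  "Gamma0 = {f. convex_fun f \<and> lower_semicontinuous f \<and> proper_fun f}"

text \<open>For proper \<open>f\<close> this is empty at every \<open>x\<close> with \<open>f x = \<infinity>\<close>.\<close>

definition subdifferential :: "('a::real_inner \<Rightarrow> ereal) \<Rightarrow> 'a \<Rightarrow> 'a set" where
  "subdifferential f x = {u. \<forall>y. ereal ((y - x) \<bullet> u) + f x \<le> f y}"

definition fenchel_conjugate :: "('a::real_inner \<Rightarrow> ereal) \<Rightarrow> 'a \<Rightarrow> ereal" where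
  "fenchel_conjugate f u = (SUP x. ereal (x \<bullet> u) - f x)"

section \<open>Self-dual properties\<close>

definition self_dual_mapping_property :: "(('a::real_inner \<Rightarrow> 'a) \<Rightarrow> bool) \<Rightarrow> bool" where
  "self_dual_mapping_property P \<longleftrightarrow>
    (\<forall>T. firmly_nonexpansive T \<longrightarrow> (P T \<longleftrightarrow> P (\<lambda>x. x - T x)))"

definition self_dual_operator_property :: "(('a::real_inner \<Rightarrow> 'a set) \<Rightarrow> bool) \<Rightarrow> bool" where
  "self_dual_operator_property P \<longleftrightarrow>
    (\<forall>A. maximally_monotone A \<longrightarrow> (P A \<longleftrightarrow> P (op_inverse A)))"

end

theory Submission
  imports Defs
begin

text \<open>
  If \<open>T = J\<^sub>A\<close>, then the graph of \<open>A\<close> is parametrised by the pairs \<open>(T y, y - T y)\<close>, under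
  which the two cyclic sums for \<open>T\<close> and \<open>A\<close> agree up to sign; traversing a cycle backwards
  exchanges \<open>A\<close> and its inverse. Rockafellar's potential, a supremum of affine functions
  obtained along chains in the graph, gives \<open>f\<close> with \<open>A \<subseteq> \<partial>f\<close>, and equality holds because \<open>\<partial>f\<close>
  is monotone and \<open>A\<close> is maximal. The same maximality argument applied to the inverse of \<open>A\<close> and
  the Fenchel--Young equality yield \<open>\<partial>f\<^sup>*\<close>.
\<close>

section \<open>Operators and resolvents\<close>

lemma op_inverse_op_inverse [simp]: "op_inverse (op_inverse A) = A"
  by (auto simp: op_inverse_def fun_eq_iff)

lemma mem_resolvent: "p \<in> resolvent A x \<longleftrightarrow> x - p \<in> A p"
  unfolding resolvent_def op_inverse_def op_add_def op_of_fun_def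
  by (auto simp: algebra_simps intro: exI[of _ "x - p"])

text \<open>Substituting \<open>x = p + u\<close> in the definition gives a normal form that
  \<open>A = T^{-1} - Id\<close> also reduces to, so the two descriptions of \<open>A\<close>
  coincide.\<close>

lemma op_of_fun_eq_resolvent_iff:
  "op_of_fun T = resolvent A \<longleftrightarrow> (\<forall>p u. u \<in> A p \<longleftrightarrow> T (p + u) = p)"
proof -
  have "op_of_fun T = resolvent A \<longleftrightarrow> (\<forall>x p. p = T x \<longleftrightarrow> x - p \<in> A p)"
    by (auto simp: fun_eq_iff set_eq_iff mem_resolvent op_of_fun_def)
  also have "\<dots> \<longleftrightarrow> (\<forall>p u. u \<in> A p \<longleftrightarrow> T (p + u) = p)"
    by (metis add_diff_cancel_left' add.commute diff_add_cancel)
  finally show ?thesis .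
qed

lemma eq_inverse_diff_id_iff:
  fixes T :: "'a::real_inner \<Rightarrow> 'a"
  shows "A = op_diff (op_inverse (op_of_fun T)) (op_of_fun id) \<longleftrightarrow>
    (\<forall>p u. u \<in> A p \<longleftrightarrow> T (p + u) = p)"
proof -
  have "u \<in> op_diff (op_inverse (op_of_fun T)) (op_of_fun id) p \<longleftrightarrow> T (p + u) = p" for p u
    unfolding op_inverse_def op_diff_def op_of_fun_def
    by (auto simp: algebra_simps intro: exI[of _ "p + u"])
  then show ?thesis
    by (auto simp: fun_eq_iff set_eq_iff)
qed

text \<open>With \<open>x = p + u\<close>, the condition \<open>T x = p\<close> is the same as
  \<open>x - T x = u\<close>; passing to the complement swaps \<open>p\<close> and
  \<open>u\<close>.\<close>

lemma resolvent_op_inverse: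
  assumes "op_of_fun T = resolvent A"
  shows "op_of_fun (\<lambda>x. x - T x) = resolvent (op_inverse A)"
  using assms unfolding op_of_fun_eq_resolvent_iff
  by (auto simp: op_inverse_def algebra_simps)

section \<open>Cyclic monotonicity\<close>

lemma cyclically_firmly_nonexpansive_iff:
  assumes "op_of_fun T = resolvent A"
  shows "cyclically_firmly_nonexpansive T \<longleftrightarrow> cyclically_monotone A"
proof
  have A: "u \<in> A p \<longleftrightarrow> T (p + u) = p" for p u
    using assms by (simp add: op_of_fun_eq_resolvent_iff)
  show "cyclically_monotone A" if T: "cyclically_firmly_nonexpansive T"
    unfolding cyclically_monotone_def
  proof (intro allI impI)
    fix n :: nat and x u :: "nat \<Rightarrow> 'a"
    assume n: "n \<ge> 2" and gr: "\<forall>i\<in>{1..n}. (x i, u i) \<in> op_graph A" and cyc: "x (n + 1) = x 1"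
    \<comment> \<open>Only \<open>x\<close> is assumed to close up, while \<open>u (n + 1)\<close>
      is arbitrary; the case distinction forces \<open>y (n + 1) = y 1\<close>.\<close>
    define y where "y i = (if i = n + 1 then x 1 + u 1 else x i + u i)" for i
    have Ty: "T (y i) = x i" if "i \<in> {1..n + 1}" for i
    proof -
      have "T (x j + u j) = x j" if "j \<in> {1..n}" for j
        using gr A that by (auto simp: op_graph_def)
      then show ?thesis
        using that n cyc by (cases "i = n + 1") (auto simp: y_def)
    qed
    have "0 \<le> (\<Sum>i=1..n. (y i - T (y i)) \<bullet> (T (y i) - T (y (i + 1))))"
      by (rule T[unfolded cyclically_firmly_nonexpansive_def, rule_format])
        (use n in \<open>auto simp: y_def\<close>)
    also have "\<dots> = (\<Sum>i=1..n. - ((x (i + 1) - x i) \<bullet> u i))"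
    proof (rule sum.cong)
      fix i assume "i \<in> {1..n}"
      then have "T (y i) = x i" "T (y (i + 1)) = x (i + 1)" "y i = x i + u i"
        using Ty[of i] Ty[of "i + 1"] by (auto simp: y_def)
      then show "(y i - T (y i)) \<bullet> (T (y i) - T (y (i + 1))) = - ((x (i + 1) - x i) \<bullet> u i)"
        by (simp add: inner_diff inner_commute)
    qed simp
    finally show "(\<Sum>i=1..n. (x (i + 1) - x i) \<bullet> u i) \<le> 0"
      by (simp add: sum_negf)
  qed
  show "cyclically_firmly_nonexpansive T" if "cyclically_monotone A"
    unfolding cyclically_firmly_nonexpansive_def
  proof (intro allI impI)
    fix n :: nat and x :: "nat \<Rightarrow> 'a"
    assume "n \<ge> 2" and "x (n + 1) = x 1"
    moreover have "(T (x i), x i - T (x i)) \<in> op_graph A" for i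
      by (simp add: op_graph_def A)
    ultimately have "(\<Sum>i=1..n. (T (x (i + 1)) - T (x i)) \<bullet> (x i - T (x i))) \<le> 0"
      using that[unfolded cyclically_monotone_def, rule_format,
        of n "\<lambda>i. T (x i)" "\<lambda>i. x i - T (x i)"] by simp
    moreover have "(x i - T (x i)) \<bullet> (T (x i) - T (x (i + 1))) =
        - ((T (x (i + 1)) - T (x i)) \<bullet> (x i - T (x i)))" for i
      by (simp add: inner_diff inner_commute)
    ultimately show "0 \<le> (\<Sum>i=1..n. (x i - T (x i)) \<bullet> (T (x i) - T (x (i + 1))))"
      by (simp add: sum_negf)
  qed
qed

lemma cyclically_monotone_op_inverse:
  assumes "cyclically_monotone A"
  shows "cyclically_monotone (op_inverse A)"
  unfolding cyclically_monotone_def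
proof (intro allI impI)
  fix n :: nat and u x :: "nat \<Rightarrow> 'a"
  assume n: "n \<ge> 2" and gr: "\<forall>i\<in>{1..n}. (u i, x i) \<in> op_graph (op_inverse A)"
    and cyc: "u (n + 1) = u 1"
  \<comment> \<open>Reversing the cycle pairs \<open>x\<^sub>i\<close> with \<open>u\<^bsub>i+1\<^esub>\<close> in the shifted terms of the sum.\<close>
  define y where "y i = (if i = n + 1 then x n else x (n + 1 - i))" for i
  define v where "v i = u (n + 1 - i)" for i
  have "(\<Sum>i=1..n. (y (i + 1) - y i) \<bullet> v i) \<le> 0"
  proof (rule assms[unfolded cyclically_monotone_def, rule_format])
    show "(y i, v i) \<in> op_graph A" if "i \<in> {1..n}" for i
    proof -
      have "n + 1 - i \<in> {1..n}" using that by auto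
      then have "(u (n + 1 - i), x (n + 1 - i)) \<in> op_graph (op_inverse A)"
        using gr by blast
      then show ?thesis
        using that by (auto simp: y_def v_def op_graph_def op_inverse_def)
    qed
  qed (use n in \<open>auto simp: y_def\<close>)
  moreover have "(\<Sum>i=1..n. y (i + 1) \<bullet> v i) = (\<Sum>i=1..n. u (i + 1) \<bullet> x i)"
  proof -
    obtain m where m: "n = Suc m" using n by (cases n) auto
    \<comment> \<open>The closing term \<open>i = n\<close> is split off; since
      \<open>u 1 = u (n + 1)\<close>, it becomes the last term of the target sum.\<close>
    have "(\<Sum>i=1..n. y (i + 1) \<bullet> v i) = (\<Sum>i=1..m. x (n - i) \<bullet> u (n + 1 - i)) + x n \<bullet> u 1"
      by (simp add: m y_def v_def)
    also have "(\<Sum>i=1..m. x (n - i) \<bullet> u (n + 1 - i)) = (\<Sum>i=1..m. x i \<bullet> u (i + 1))"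
      by (rule sum.reindex_bij_witness[of _ "\<lambda>i. n - i" "\<lambda>i. n - i"]) (auto simp: m Suc_diff_le)
    finally show ?thesis
      using cyc by (simp add: m inner_commute)
  qed
  moreover have "(\<Sum>i=1..n. y i \<bullet> v i) = (\<Sum>i=1..n. u i \<bullet> x i)"
    by (rule sum.reindex_bij_witness[of _ "\<lambda>i. n + 1 - i" "\<lambda>i. n + 1 - i"])
      (auto simp: y_def v_def inner_commute)
  ultimately show "(\<Sum>i=1..n. (u (i + 1) - u i) \<bullet> x i) \<le> 0"
    by (simp add: inner_diff_left sum_subtractf)
qed

lemma cyclically_monotone_op_inverse_iff:
  "cyclically_monotone (op_inverse A) \<longleftrightarrow> cyclically_monotone A"
  using cyclically_monotone_op_inverse[of A] cyclically_monotone_op_inverse[of "op_inverse A"] by auto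

text \<open>\<open>T\<close> is by construction the resolvent of \<open>T^{-1} - Id\<close>, so both
  sides become cyclic monotonicity of this operator and of its inverse.\<close>

lemma cyclically_firmly_nonexpansive_complement_iff:
  fixes T :: "'a::real_inner \<Rightarrow> 'a"
  shows "cyclically_firmly_nonexpansive (\<lambda>x. x - T x) \<longleftrightarrow> cyclically_firmly_nonexpansive T"
proof -
  have T: "op_of_fun T = resolvent (op_diff (op_inverse (op_of_fun T)) (op_of_fun id))"
    by (subst op_of_fun_eq_resolvent_iff) (simp flip: eq_inverse_diff_id_iff)
  show ?thesis
    using cyclically_firmly_nonexpansive_iff[OF T]
      cyclically_firmly_nonexpansive_iff[OF resolvent_op_inverse[OF T]]
    by (simp add: cyclically_monotone_op_inverse_iff)
qed

lemma cyclically_monotone_imp_monotone_op: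
  assumes "cyclically_monotone A"
  shows "monotone_op A"
  unfolding monotone_op_def
proof clarify
  fix x u y v
  assume "(x, u) \<in> op_graph A" "(y, v) \<in> op_graph A"
  \<comment> \<open>The two-point cycle \<open>x, y, x\<close>.\<close>
  then have "(\<Sum>i=1..2. ((if i + 1 = 2 then y else x) - (if i = 2 then y else x)) \<bullet>
      (if i = (2::nat) then v else u)) \<le> 0"
    using assms[unfolded cyclically_monotone_def, rule_format,
      of 2 "\<lambda>i. if i = 2 then y else x" "\<lambda>i. if i = 2 then v else u"] by simp
  moreover have "{1..2::nat} = {1, 2}" by auto
  ultimately show "0 \<le> (x - y) \<bullet> (u - v)"
    by (simp add: inner_diff)
qed

section \<open>Maximal monotonicity and passage to the inverse\<close>

lemma maximally_monotone_eqI: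
  assumes "maximally_monotone A" "monotone_op B" "\<And>x u. u \<in> A x \<Longrightarrow> u \<in> B x"
  shows "A = B"
proof -
  have "op_graph A \<subseteq> op_graph B"
    using assms(3) by (auto simp: op_graph_def)
  then have "op_graph A = op_graph B"
    using assms(1,2) by (auto simp: maximally_monotone_def)
  then show ?thesis
    by (auto simp: op_graph_def fun_eq_iff set_eq_iff)
qed

text \<open>The operator with empty graph is properly extended by the single pair
  \<open>(0, 0)\<close>. This supplies a starting point for Rockafellar's chains.\<close>

lemma maximally_monotone_nonempty:
  fixes A :: "'a::real_inner \<Rightarrow> 'a set"
  assumes "maximally_monotone A"
  obtains x u where "u \<in> A x"
proof (rule ccontr)
  assume "\<not> thesis"
  then have empty: "u \<notin> A x" for u x using that by blast
  define B :: "'a \<Rightarrow> 'a set" where "B x = (if x = 0 then {0} else {})" for x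
  have "monotone_op B"
    by (auto simp: monotone_op_def op_graph_def B_def split: if_splits)
  then have "A = B"
    using empty by (intro maximally_monotone_eqI[OF assms]) auto
  then show False
    using empty[of 0 0] by (simp add: B_def)
qed

lemma monotone_op_inverse:
  "monotone_op A \<Longrightarrow> monotone_op (op_inverse A)"
  unfolding monotone_op_def op_graph_def op_inverse_def
  by (clarsimp, subst inner_commute) blast

lemma maximally_monotone_op_inverse:
  assumes "maximally_monotone A"
  shows "maximally_monotone (op_inverse A)"
  unfolding maximally_monotone_def
proof (intro conjI notI)
  show "monotone_op (op_inverse A)"
    using assms by (auto simp: maximally_monotone_def intro: monotone_op_inverse)
  assume "\<exists>B. monotone_op B \<and> op_graph (op_inverse A) \<subset> op_graph B"
  then obtain B where B: "monotone_op B" "op_graph (op_inverse A) \<subset> op_graph B"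
    by blast
  have "A = op_inverse B"
    using B by (intro maximally_monotone_eqI[OF assms] monotone_op_inverse)
      (auto simp: op_graph_def op_inverse_def)
  then show False
    using B(2) by simp
qed

section \<open>Subdifferentials\<close>

lemma subdifferential_finite:
  assumes "proper_fun f" "u \<in> subdifferential f x"
  obtains r where "f x = ereal r"
proof -
  obtain y where "f y \<noteq> \<infinity>"
    using assms(1) by (auto simp: proper_fun_def)
  moreover have "ereal ((y - x) \<bullet> u) + f x \<le> f y"
    using assms(2) by (auto simp: subdifferential_def)
  ultimately have "f x \<noteq> \<infinity>" by auto
  moreover have "f x \<noteq> -\<infinity>"
    using assms(1) by (auto simp: proper_fun_def)
  ultimately show ?thesis
    using that by (cases "f x") auto
qed

text \<open>The subgradient inequalities along the cycle add up to a telescoping sum; finiteness of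
  \<open>f\<close> at the points of the cycle allows the subtraction.\<close>

lemma cyclically_monotone_subdifferential:
  assumes "proper_fun f"
  shows "cyclically_monotone (subdifferential f)"
  unfolding cyclically_monotone_def
proof (intro allI impI)
  fix n :: nat and x u :: "nat \<Rightarrow> 'a"
  assume n: "n \<ge> 2" and gr: "\<forall>i\<in>{1..n}. (x i, u i) \<in> op_graph (subdifferential f)"
    and cyc: "x (n + 1) = x 1"
  have sub: "u i \<in> subdifferential f (x i)" if "i \<in> {1..n}" for i
    using gr that by (auto simp: op_graph_def)
  define r where "r i = real_of_ereal (f (x i))" for i
  have r: "f (x i) = ereal (r i)" if "i \<in> {1..n + 1}" for i
  proof -
    have "f (x j) = ereal (r j)" if "j \<in> {1..n}" for j
    proof -
      obtain c where "f (x j) = ereal c"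
        using subdifferential_finite[OF assms sub[OF \<open>j \<in> {1..n}\<close>]] .
      then show ?thesis by (simp add: r_def)
    qed
    moreover have "f (x (n + 1)) = ereal (r (n + 1))"
      using calculation[of 1] n cyc by (simp add: r_def)
    ultimately show ?thesis
      using that by (cases "i = n + 1") auto
  qed
  have "(\<Sum>i=1..n. (x (i + 1) - x i) \<bullet> u i) \<le> (\<Sum>i=1..n. r (i + 1) - r i)"
  proof (rule sum_mono)
    fix i assume i: "i \<in> {1..n}"
    have "ereal ((x (i + 1) - x i) \<bullet> u i) + f (x i) \<le> f (x (i + 1))"
      using sub[OF i] by (auto simp: subdifferential_def)
    then show "(x (i + 1) - x i) \<bullet> u i \<le> r (i + 1) - r i"
      using r[of i] r[of "i + 1"] i by simp
  qed
  also have "\<dots> = r (n + 1) - r 1"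
    using n sum_Suc_diff[of 1 n r] by simp
  also have "\<dots> = 0"
    using cyc by (simp add: r_def)
  finally show "(\<Sum>i=1..n. (x (i + 1) - x i) \<bullet> u i) \<le> 0" .
qed

section \<open>Suprema of affine functions and Rockafellar's potential\<close>

lemma convex_fun_SUP_affine:
  fixes S :: "('a::real_inner \<times> real) set"
  shows "convex_fun (\<lambda>y. SUP (u, b)\<in>S. ereal (y \<bullet> u + b))" (is "convex_fun ?f")
  unfolding convex_fun_def
proof (intro allI impI)
  fix x y :: 'a and t :: real
  assume t: "0 < t" "t < 1"
  show "?f ((1 - t) *\<^sub>R x + t *\<^sub>R y) \<le> ereal (1 - t) * ?f x + ereal t * ?f y"
  proof (rule SUP_least, clarify)
    fix u b assume ub: "(u, b) \<in> S"
    have le: "ereal (z \<bullet> u + b) \<le> ?f z" for z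
      using ub by (auto intro: SUP_upper2)
    have "((1 - t) *\<^sub>R x + t *\<^sub>R y) \<bullet> u + b = (1 - t) * (x \<bullet> u + b) + t * (y \<bullet> u + b)"
      by (simp add: inner_add_left algebra_simps)
    then have "ereal (((1 - t) *\<^sub>R x + t *\<^sub>R y) \<bullet> u + b) =
        ereal (1 - t) * ereal (x \<bullet> u + b) + ereal t * ereal (y \<bullet> u + b)"
      by simp
    also have "\<dots> \<le> ereal (1 - t) * ?f x + ereal t * ?f y"
      using t by (intro add_mono ereal_mult_left_mono le) auto
    finally show "ereal (((1 - t) *\<^sub>R x + t *\<^sub>R y) \<bullet> u + b) \<le> \<dots>" .
  qed
qed

text \<open>If the supremum exceeds \<open>c\<close> at \<open>x\<close>, a single affine member
  does, and by continuity it still does near \<open>x\<close>.\<close>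

lemma lower_semicontinuous_SUP_affine:
  fixes S :: "('a::real_inner \<times> real) set"
  shows "lower_semicontinuous (\<lambda>y. SUP (u, b)\<in>S. ereal (y \<bullet> u + b))"
    (is "lower_semicontinuous ?f")
  unfolding lower_semicontinuous_def le_Liminf_iff
proof (intro allI impI)
  fix x c assume "c < ?f x"
  then obtain u b where ub: "(u, b) \<in> S" and c: "c < ereal (x \<bullet> u + b)"
    by (auto simp: less_SUP_iff)
  have "((\<lambda>y. ereal (y \<bullet> u + b)) \<longlongrightarrow> ereal (x \<bullet> u + b)) (at x)"
    by (intro tendsto_intros)
  then have "\<forall>\<^sub>F y in at x. c < ereal (y \<bullet> u + b)"
    using c by (rule order_tendstoD)
  then show "\<forall>\<^sub>F y in at x. c < ?f y"
  proof eventually_elim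
    case (elim y)
    then show ?case using ub by (auto simp: less_SUP_iff intro!: bexI[of _ "(u, b)"])
  qed
qed

text \<open>
  Slopes and intercepts of the affine functions
  \<open>y \<mapsto> \<langle>y - x\<^sub>n, u\<^sub>n\<rangle> + \<langle>x\<^sub>n - x\<^bsub>n-1\<^esub>, u\<^bsub>n-1\<^esub>\<rangle> + \<dots> + \<langle>x\<^sub>1 - x\<^sub>0, u\<^sub>0\<rangle>\<close>
  whose supremum is Rockafellar's potential.
\<close>

inductive chain_affine :: "('a::real_inner \<Rightarrow> 'a set) \<Rightarrow> 'a \<Rightarrow> 'a \<Rightarrow> 'a \<Rightarrow> real \<Rightarrow> bool"
  for A x0 u0 where
  base: "chain_affine A x0 u0 u0 (- (x0 \<bullet> u0))"
| step: "chain_affine A x0 u0 u b \<Longrightarrow> v \<in> A y \<Longrightarrow>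
    chain_affine A x0 u0 v (y \<bullet> u + b - y \<bullet> v)"

text \<open>Unrolls the induction into an indexed chain, ready for cyclic monotonicity. The sum
  stops before \<open>n\<close> because the last slope \<open>w n\<close> belongs to the affine
  function itself.\<close>

lemma chain_affine_sequence:
  assumes "chain_affine A x0 u0 u b" "u0 \<in> A x0"
  shows "\<exists>n::nat\<ge>1. \<exists>x w. x 1 = x0 \<and> w n = u \<and> (\<forall>i\<in>{1..n}. w i \<in> A (x i)) \<and>
    x n \<bullet> u + b = (\<Sum>i=1..<n. (x (i + 1) - x i) \<bullet> w i)"
  using assms
proof induction
  case base
  then show ?case
    by (intro exI[of _ "1::nat"] conjI exI[of _ "\<lambda>_. x0"] exI[of _ "\<lambda>_. u0"]) (auto simp: inner_commute)
next
  case (step u b v y)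
  then obtain n :: nat and x w where n: "n \<ge> 1" and *: "x 1 = x0" "w n = u" "\<forall>i\<in>{1..n}. w i \<in> A (x i)"
      "x n \<bullet> u + b = (\<Sum>i=1..<n. (x (i + 1) - x i) \<bullet> w i)"
    by blast
  let ?x = "x(Suc n := y)" and ?w = "w(Suc n := v)"
  have "(\<Sum>i=1..<Suc n. (?x (i + 1) - ?x i) \<bullet> ?w i) =
      (\<Sum>i=1..<n. (x (i + 1) - x i) \<bullet> w i) + (y - x n) \<bullet> u"
    using n * by simp
  \<comment> \<open>The new intercept makes the new affine function agree with the old one at
    \<open>y\<close>.\<close>
  also have "\<dots> = y \<bullet> v + (y \<bullet> u + b - y \<bullet> v)"
    using *(4) by (simp add: inner_diff_left)
  finally show ?case
    using n * step.hyps(2)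
    by (intro exI[of _ "Suc n"] conjI exI[of _ ?x] exI[of _ ?w]) (auto simp: le_Suc_eq)
qed

text \<open>Closing the chain by a return to \<open>x0\<close> turns the value at \<open>x0\<close>
  into a cyclic sum.\<close>

lemma chain_affine_nonpos:
  assumes "cyclically_monotone A" "u0 \<in> A x0" "chain_affine A x0 u0 u b"
  shows "x0 \<bullet> u + b \<le> 0"
proof -
  obtain n :: nat and x w where n: "n \<ge> 1" and *: "x 1 = x0" "w n = u" "\<forall>i\<in>{1..n}. w i \<in> A (x i)"
      "x n \<bullet> u + b = (\<Sum>i=1..<n. (x (i + 1) - x i) \<bullet> w i)"
    using chain_affine_sequence[OF assms(3,2)] by blast
  show ?thesis
  \<comment> \<open>Cyclic monotonicity speaks only of cycles with \<open>n \<ge> 2\<close>; for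
    \<open>n = 1\<close> the value at \<open>x0\<close> is an empty sum.\<close>
  proof (cases "n = 1")
    case True
    then show ?thesis using * by simp
  next
    case False
    let ?x = "x(n + 1 := x0)"
    have "(\<Sum>i=1..n. (?x (i + 1) - ?x i) \<bullet> w i) \<le> 0"
      using n False * by (intro assms(1)[unfolded cyclically_monotone_def, rule_format])
        (auto simp: op_graph_def)
    also have "{1..n} = insert n {1..<n}"
      using n by auto
    finally show ?thesis
      using * by (simp add: inner_diff_left)
  qed
qed

theorem Rockafellar_potential:
  assumes "cyclically_monotone A" "u0 \<in> A x0"
  obtains f where "f \<in> Gamma0" "\<And>x u. u \<in> A x \<Longrightarrow> u \<in> subdifferential f x"
proof -
  define S where "S = {(u, b). chain_affine A x0 u0 u b}"
  define f where "f y = (SUP (u, b)\<in>S. ereal (y \<bullet> u + b))" for y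
  have upper: "ereal (y \<bullet> u + b) \<le> f y" if "chain_affine A x0 u0 u b" for y u b
    unfolding f_def using that by (auto simp: S_def intro: SUP_upper2)
  \<comment> \<open>Properness: this bound excludes \<open>f\<close> being constantly infinite, and
    the base affine function bounds \<open>f\<close> from below.\<close>
  have "f x0 \<le> 0"
    unfolding f_def using chain_affine_nonpos[OF assms]
    by (intro SUP_least) (auto simp: S_def)
  then have "proper_fun f"
    using upper[OF chain_affine.base] unfolding proper_fun_def
    by (metis ereal_infty_less_eq(2) MInfty_neq_ereal(1) ereal_infty_less_eq(1) zero_ereal_def PInfty_neq_ereal(1))
  then have "f \<in> Gamma0"
    using convex_fun_SUP_affine[of S] lower_semicontinuous_SUP_affine[of S]
    by (simp add: Gamma0_def f_def[abs_def])
  moreover have "v \<in> subdifferential f x" if v: "v \<in> A x" for x v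
    unfolding subdifferential_def
  proof clarify
    fix y
    have "f x \<le> f y - ereal ((y - x) \<bullet> v)"
      unfolding f_def[of x]
    proof (rule SUP_least, clarify)
      fix u b assume "(u, b) \<in> S"
      \<comment> \<open>Appending \<open>(x, v)\<close> to the chain gives an affine function of
        slope \<open>v\<close> with the same value at \<open>x\<close>.\<close>
      then have "ereal (y \<bullet> v + (x \<bullet> u + b - x \<bullet> v)) \<le> f y"
        using v by (intro upper chain_affine.step) (simp_all add: S_def)
      then show "ereal (x \<bullet> u + b) \<le> f y - ereal ((y - x) \<bullet> v)"
        by (cases "f y") (auto simp: inner_diff_left)
    qed
    then show "ereal ((y - x) \<bullet> v) + f x \<le> f y"
      by (cases "f x"; cases "f y") auto
  qed
  ultimately show thesis
    by (rule that)
qed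

section \<open>Conjugates\<close>

text \<open>Fenchel--Young equality: the subgradient inequality says that the supremum defining the
  conjugate is attained at \<open>x\<close>.\<close>

lemma subdifferential_conjugate_eq:
  assumes "u \<in> subdifferential f x" "f x = ereal r"
  shows "fenchel_conjugate f u = ereal (x \<bullet> u - r)"
  unfolding fenchel_conjugate_def
proof (rule antisym)
  show "(SUP y. ereal (y \<bullet> u) - f y) \<le> ereal (x \<bullet> u - r)"
  proof (rule SUP_least)
    fix y
    have "ereal ((y - x) \<bullet> u) + f x \<le> f y"
      using assms(1) by (auto simp: subdifferential_def)
    then show "ereal (y \<bullet> u) - f y \<le> ereal (x \<bullet> u - r)"
      using assms(2) by (cases "f y") (auto simp: inner_diff_left)
  qed
  show "ereal (x \<bullet> u - r) \<le> (SUP y. ereal (y \<bullet> u) - f y)"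
    using assms(2) by (auto intro!: SUP_upper2[of x])
qed

lemma fenchel_conjugate_ge: "ereal (x \<bullet> u) - f x \<le> fenchel_conjugate f u"
  unfolding fenchel_conjugate_def by (rule SUP_upper) simp

lemma fenchel_conjugate_neq_MInfty:
  assumes "proper_fun f"
  shows "fenchel_conjugate f u \<noteq> -\<infinity>"
proof -
  obtain x where "f x \<noteq> \<infinity>" "f x \<noteq> -\<infinity>"
    using assms by (auto simp: proper_fun_def)
  then show ?thesis
    using fenchel_conjugate_ge[of x u f] by (cases "f x") auto
qed

text \<open>Subtract the Fenchel--Young equality at \<open>(x, u)\<close> from the inequality at
  \<open>(x, v)\<close>.\<close>

lemma subdifferential_conjugate:
  assumes "proper_fun f" "u \<in> subdifferential f x"
  shows "x \<in> subdifferential (fenchel_conjugate f) u"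
  unfolding subdifferential_def
proof clarify
  fix v
  obtain r where r: "f x = ereal r"
    using subdifferential_finite[OF assms] .
  show "ereal ((v - u) \<bullet> x) + fenchel_conjugate f u \<le> fenchel_conjugate f v"
    using fenchel_conjugate_ge[of x v f] r subdifferential_conjugate_eq[OF assms(2) r]
    by (simp add: inner_diff inner_commute)
qed

section \<open>Subdifferential descriptions of \<open>A\<close> and of its inverse\<close>

lemma cyclically_monotone_iff_subdifferential:
  assumes "maximally_monotone A"
  shows "cyclically_monotone A \<longleftrightarrow> (\<exists>f\<in>Gamma0. A = subdifferential f)"
proof
  assume cyc: "cyclically_monotone A"
  obtain x0 u0 where "u0 \<in> A x0"
    using maximally_monotone_nonempty[OF assms] .
  with cyc obtain f where f: "f \<in> Gamma0" "\<And>x u. u \<in> A x \<Longrightarrow> u \<in> subdifferential f x"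
    using Rockafellar_potential by blast
  moreover have "monotone_op (subdifferential f)"
    using f(1) by (intro cyclically_monotone_imp_monotone_op cyclically_monotone_subdifferential)
      (simp add: Gamma0_def)
  ultimately show "\<exists>f\<in>Gamma0. A = subdifferential f"
    using maximally_monotone_eqI[OF assms] by blast
qed (auto simp: Gamma0_def intro: cyclically_monotone_subdifferential)

text \<open>One inclusion is \<open>subdifferential_conjugate\<close>; maximality of the inverse
  upgrades it to equality, in place of a biconjugation argument.\<close>

lemma op_inverse_subdifferential:
  assumes "maximally_monotone (subdifferential f)" "proper_fun f"
  shows "op_inverse (subdifferential f) = subdifferential (fenchel_conjugate f)"
proof (rule maximally_monotone_eqI)
  show "maximally_monotone (op_inverse (subdifferential f))"
    by (rule maximally_monotone_op_inverse[OF assms(1)])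
  \<comment> \<open>A single subgradient makes the conjugate finite at \<open>u\<close>, hence
    proper.\<close>
  obtain x u where xu: "u \<in> subdifferential f x"
    using maximally_monotone_nonempty[OF assms(1)] .
  obtain r where "f x = ereal r"
    using subdifferential_finite[OF assms(2) xu] .
  then have "fenchel_conjugate f u \<noteq> \<infinity>"
    using subdifferential_conjugate_eq[OF xu] by simp
  then have "proper_fun (fenchel_conjugate f)"
    using fenchel_conjugate_neq_MInfty[OF assms(2)] by (auto simp: proper_fun_def)
  then show "monotone_op (subdifferential (fenchel_conjugate f))"
    by (intro cyclically_monotone_imp_monotone_op cyclically_monotone_subdifferential)
qed (use subdifferential_conjugate[OF assms(2)] in \<open>auto simp: op_inverse_def\<close>)

text \<open>
  If \<open>f\<^sup>*\<close> were not proper, it would be constantly \<open>\<infinity>\<close> and \<open>\<partial>f\<^sup>*\<close> would be all of \<open>X \<times> X\<close>,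
  which is monotone only in the zero space; so no affine minorant of \<open>f\<close> is needed.
\<close>

lemma cyclically_monotone_subdifferential_conjugate:
  fixes f :: "'a::real_inner \<Rightarrow> ereal"
  assumes "monotone_op (subdifferential (fenchel_conjugate f))" "proper_fun f"
  shows "cyclically_monotone (subdifferential (fenchel_conjugate f))"
proof (cases "proper_fun (fenchel_conjugate f)")
  case True
  then show ?thesis by (rule cyclically_monotone_subdifferential)
next
  case False
  then have "fenchel_conjugate f u = \<infinity>" for u
    using fenchel_conjugate_neq_MInfty[OF assms(2)] by (auto simp: proper_fun_def)
  then have "(x, u) \<in> op_graph (subdifferential (fenchel_conjugate f))" for x u
    by (simp add: op_graph_def subdifferential_def)
  then have mono: "0 \<le> (x - y) \<bullet> (u - v)" for x y u v :: 'a
    using assms(1) unfolding monotone_op_def by blast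
  have "x = 0" for x :: 'a
    \<comment> \<open>This instance reads \<open>0 \<le> - (x \<bullet> x)\<close>.\<close>
    using mono[of x 0 0 x] by (simp flip: power2_norm_eq_inner)
  then have "x \<bullet> y = 0" for x y :: 'a
    by (metis inner_zero_left)
  then show ?thesis
    by (simp add: cyclically_monotone_def)
qed

text \<open>Forwards, the \<open>f\<close> with \<open>A = subdifferential f\<close> serves.
  Backwards, \<open>f\<close> is not known to be tied to \<open>A\<close> in this way, so cyclic
  monotonicity is read off from the conjugate itself.\<close>

lemma cyclically_monotone_iff_subdifferential_conjugate:
  assumes "maximally_monotone A"
  shows "cyclically_monotone (op_inverse A) \<longleftrightarrow>
    (\<exists>f\<in>Gamma0. op_inverse A = subdifferential (fenchel_conjugate f))"
proof
  assume "cyclically_monotone (op_inverse A)"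
  then obtain f where "f \<in> Gamma0" "A = subdifferential f"
    using cyclically_monotone_iff_subdifferential[OF assms]
    by (auto simp: cyclically_monotone_op_inverse_iff)
  then show "\<exists>f\<in>Gamma0. op_inverse A = subdifferential (fenchel_conjugate f)"
    using op_inverse_subdifferential assms by (auto simp: Gamma0_def)
next
  assume "\<exists>f\<in>Gamma0. op_inverse A = subdifferential (fenchel_conjugate f)"
  then show "cyclically_monotone (op_inverse A)"
    using maximally_monotone_op_inverse[OF assms] cyclically_monotone_subdifferential_conjugate
    by (auto simp: Gamma0_def maximally_monotone_def)
qed

theorem theorem3p13:
  fixes T :: "'a::{real_inner, complete_space} \<Rightarrow> 'a"
    and A :: "'a \<Rightarrow> 'a set"
  assumes "firmly_nonexpansive T"
    and "maximally_monotone A"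
  shows "(op_of_fun T = resolvent A \<longleftrightarrow>
          A = op_diff (op_inverse (op_of_fun T)) (op_of_fun id)) \<and>
    (op_of_fun T = resolvent A \<longrightarrow>
      (cyclically_firmly_nonexpansive T \<longleftrightarrow> cyclically_monotone A) \<and>
      (cyclically_monotone A \<longleftrightarrow> (\<exists>f\<in>Gamma0. A = subdifferential f)) \<and>
      ((\<exists>f\<in>Gamma0. A = subdifferential f) \<longleftrightarrow>
        cyclically_firmly_nonexpansive (\<lambda>x. x - T x)) \<and>
      (cyclically_firmly_nonexpansive (\<lambda>x. x - T x) \<longleftrightarrow>
        cyclically_monotone (op_inverse A)) \<and>
      (cyclically_monotone (op_inverse A) \<longleftrightarrow>
        (\<exists>f\<in>Gamma0. op_inverse A = subdifferential (fenchel_conjugate f)))) \<and>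
    self_dual_mapping_property (cyclically_firmly_nonexpansive :: ('a \<Rightarrow> 'a) \<Rightarrow> bool) \<and>
    self_dual_operator_property (cyclically_monotone :: ('a \<Rightarrow> 'a set) \<Rightarrow> bool)"
proof (intro conjI impI)
  show "op_of_fun T = resolvent A \<longleftrightarrow>
      A = op_diff (op_inverse (op_of_fun T)) (op_of_fun id)"
    by (simp only: op_of_fun_eq_resolvent_iff eq_inverse_diff_id_iff)
  show "self_dual_mapping_property (cyclically_firmly_nonexpansive :: ('a \<Rightarrow> 'a) \<Rightarrow> bool)"
    by (simp add: self_dual_mapping_property_def cyclically_firmly_nonexpansive_complement_iff)
  show "self_dual_operator_property (cyclically_monotone :: ('a \<Rightarrow> 'a set) \<Rightarrow> bool)"
    by (simp add: self_dual_operator_property_def cyclically_monotone_op_inverse_iff)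
  assume T: "op_of_fun T = resolvent A"
  \<comment> \<open>These link every condition to cyclic monotonicity of \<open>A\<close>.\<close>
  note eqs = cyclically_firmly_nonexpansive_iff[OF T] cyclically_firmly_nonexpansive_complement_iff
    cyclically_monotone_op_inverse_iff cyclically_monotone_iff_subdifferential[OF assms(2)]
    cyclically_monotone_iff_subdifferential_conjugate[OF assms(2)]
  show "cyclically_firmly_nonexpansive T \<longleftrightarrow> cyclically_monotone A"
    and "cyclically_monotone A \<longleftrightarrow> (\<exists>f\<in>Gamma0. A = subdifferential f)"
    and "(\<exists>f\<in>Gamma0. A = subdifferential f) \<longleftrightarrow>
      cyclically_firmly_nonexpansive (\<lambda>x. x - T x)"
    and "cyclically_firmly_nonexpansive (\<lambda>x. x - T x) \<longleftrightarrow> cyclically_monotone (op_inverse A)"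
    and "cyclically_monotone (op_inverse A) \<longleftrightarrow>
      (\<exists>f\<in>Gamma0. op_inverse A = subdifferential (fenchel_conjugate f))"
    using eqs by blast+
qed

end
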